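(* Let $S$ be an almost symmetric numerical semigroup. Let $K=\{k\in\mathbb{Z} \mid f(S)-k\notin S\}$ and let $\mathcal{D}(S)$ be the set of symmetric numerical semigroups $\overline{S}$ with $S=\frac{\overline{S}}{2}$. Then the element with minimal genus in the family $\mathcal{D}(S)$ is $S \Join^b K$, where $b$ is the minimum odd element of $S$. Its genus is $f(S)+\frac{b+1}{2}$.
   Context: $\mathbb{N}$ denotes the set of nonnegative integers. A numerical semigroup is a submonoid $S$ of $(\mathbb{N},+)$ (so $0\in S$) such that $\mathbb{N}\setminus S$ is finite. The genus $g(S)$ is the cardinality of $\mathbb{N}\setminus S$, and the Frobenius number $f(S)$ is the largest integer not belonging to $S$. The quotient $\frac{T}{2}$ of a numerical semigroup $T$ is $\{s\in\mathbb{N} \mid 2s\in T\}$. The set of pseudo-Frobenius numbers of $S$ is $\mathrm{PF}(S)=\{x\in\mathbb{Z}\setminus S \mid x+s\in S \text{ for all } s\in S\setminus\{0\}\}$, and the type of $S$ is $t(S)=|\mathrm{PF}(S)|$. $S$ is symmetric if it has type one. Put $\mathrm{L}(S)=\{x\in\mathbb{Z}\setminus S \mid f(S)-x\notin S\}$; $S$ is almost symmetric if $\mathrm{L}(S)\subseteq \mathrm{PF}(S)$. For $X\subseteq\mathbb{Z}$, $2\cdot X=\{2x \mid x\in X\}$. For an odd element $b\in S$, $S\Join^b K = 2\cdot S\cup(2\cdot K+b)$, where $2\cdot K+b=\{2k+b\mid k\in K\}$. "The element with minimal genus" refers to the unique member of $\mathcal{D}(S)$ whose genus is minimal. *)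

theory Defs
  imports Complex_Main
begin

text \<open>Numerical semigroups are represented as sets of integers contained in \<open>\<nat>\<close>, because
  pseudo-Frobenius numbers, \<open>L(S)\<close> and \<open>K(S)\<close> are defined by quantifying over all integers.\<close>

definition numerical_semigroup :: "int set \<Rightarrow> bool" where
  "numerical_semigroup S \<longleftrightarrow>
     S \<subseteq> \<nat> \<and> 0 \<in> S \<and> (\<forall>x\<in>S. \<forall>y\<in>S. x + y \<in> S) \<and> finite (\<nat> - S)"

definition genus :: "int set \<Rightarrow> nat" where
  "genus S = card (\<nat> - S)"

text \<open>The maximum is over all integers, so the Frobenius number of \<open>\<nat>\<close> is \<open>-1\<close>.\<close>

definition frobenius :: "int set \<Rightarrow> int" where
  "frobenius S = (GREATEST x. x \<notin> S)"

definition half :: "int set \<Rightarrow> int set" where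
  "half T = {s \<in> \<nat>. 2 * s \<in> T}"

definition pseudo_frobenius :: "int set \<Rightarrow> int set" where
  "pseudo_frobenius S = {x. x \<notin> S \<and> (\<forall>s \<in> S - {0}. x + s \<in> S)}"

definition semigroup_type :: "int set \<Rightarrow> nat" where
  "semigroup_type S = card (pseudo_frobenius S)"

definition symmetric :: "int set \<Rightarrow> bool" where
  "symmetric S \<longleftrightarrow> semigroup_type S = 1"

definition L_set :: "int set \<Rightarrow> int set" where
  "L_set S = {x. x \<notin> S \<and> frobenius S - x \<notin> S}"

definition almost_symmetric :: "int set \<Rightarrow> bool" where
  "almost_symmetric S \<longleftrightarrow> L_set S \<subseteq> pseudo_frobenius S"

definition canonical_ideal :: "int set \<Rightarrow> int set" where
  "canonical_ideal S = {k. frobenius S - k \<notin> S}"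

definition symmetric_doubles :: "int set \<Rightarrow> int set set" where
  "symmetric_doubles S = {T. numerical_semigroup T \<and> symmetric T \<and> S = half T}"

definition duplication :: "int set \<Rightarrow> int \<Rightarrow> int set \<Rightarrow> int set"
    ("_ \<Join>\<^bsup>_\<^esup> _" [66, 0, 66] 65) where
  "S \<Join>\<^bsup>b\<^esup> K = {2 * x | x. x \<in> S} \<union> {2 * k + b | k. k \<in> K}"

definition min_odd :: "int set \<Rightarrow> int" where
  "min_odd S = (LEAST b. b \<in> S \<and> odd b)"

end

theory Submission
  imports Defs
begin

text \<open>A numerical semigroup \<open>T\<close> is symmetric exactly when the reflection \<open>x \<mapsto> F - x\<close> at its
  Frobenius number \<open>F\<close> exchanges \<open>T\<close> with its complement in \<open>\<int>\<close>
  (\<open>symmetric_iff_reflection\<close>). Two consequences carry the proof. Such a \<open>T\<close> has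
  genus \<open>(F + 1) / 2\<close>, so minimising the genus means minimising \<open>F\<close>; and \<open>F\<close> is odd,
  so the reflection exchanges even and odd integers, and the odd elements of \<open>T\<close> are determined by
  its even elements, that is, by \<open>S = T / 2\<close>. Writing \<open>F = 2 f(S) + c\<close> with \<open>c\<close> odd,
  this determination reads \<open>T = S \<Join>\<^bsup>c\<^esup> K\<close>
  (\<open>symmetric_double_is_duplication\<close>).

  Since \<open>0 \<in> K\<close>, the element \<open>c\<close> lies in \<open>T\<close>, hence \<open>2 c \<in> T\<close> and \<open>c \<in> S\<close>. So
  every double is a duplication along an odd element \<open>c\<close> of \<open>S\<close>, of genus
  \<open>f(S) + (c + 1) / 2\<close>, which is strictly increasing in \<open>c\<close>.

  Almost symmetry guarantees that the least odd element of \<open>S\<close> is admissible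
  (\<open>duplication_in_symmetric_doubles\<close>): closure of \<open>S \<Join>\<^bsup>b\<^esup> K\<close> under the sum of two
  odd elements amounts to \<open>K + K + b \<subseteq> S\<close>, and this holds because \<open>K \<subseteq> S \<union> L(S)\<close> consists
  of elements of \<open>S\<close> and of pseudo-Frobenius numbers, so that adding a nonzero element of \<open>S\<close> to
  an element of \<open>K\<close> leads into \<open>S\<close>. This is used twice: \<open>l + b \<in> S\<close> for \<open>l \<in> K\<close>, and then
  \<open>k + (l + b) \<in> S\<close> for \<open>k \<in> K\<close>, where \<open>l + b > 0\<close> because \<open>K\<close> is nonnegative and \<open>b\<close>
  positive.\<close>

section \<open>Frobenius number and least odd element\<close>

lemma frobenius_eqI:
  assumes "f \<notin> S" and "\<And>x. x > f \<Longrightarrow> x \<in> S"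
  shows "frobenius S = f"
  unfolding frobenius_def
proof (rule Greatest_equality)
  show "f \<notin> S" by fact
  show "y \<le> f" if "y \<notin> S" for y using assms(2) that by force
qed

lemma frobenius_properties:
  assumes "numerical_semigroup S"
  shows frobenius_not_in: "frobenius S \<notin> S"
    and gt_frobenius_in: "x > frobenius S \<Longrightarrow> x \<in> S"
    and frobenius_ge: "frobenius S \<ge> -1"
proof -
  \<comment> \<open>The element \<open>-1\<close> keeps the set nonempty, and is the maximum when \<open>S = \<nat>\<close>.\<close>
  define f where "f = Max (insert (-1) (\<nat> - S))"
  have fin: "finite (insert (-1) (\<nat> - S))" and sub: "S \<subseteq> \<nat>"
    using assms by (auto simp: numerical_semigroup_def)
  have "f \<in> insert (-1) (\<nat> - S)" unfolding f_def by (rule Max_in) (use fin in auto)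
  with sub have 1: "f \<notin> S" by (auto simp: Nats_altdef1)
  have 3: "f \<ge> -1" unfolding f_def by (rule Max_ge) (use fin in auto)
  have 2: "y \<in> S" if "y > f" for y
  proof (rule ccontr)
    assume "y \<notin> S"
    with that 3 have "y \<in> insert (-1) (\<nat> - S)" by (auto simp: Nats_altdef1)
    then have "y \<le> f" unfolding f_def by (rule Max_ge[OF fin])
    with that show False by simp
  qed
  have eq: "frobenius S = f" by (rule frobenius_eqI[OF 1 2])
  show "frobenius S \<notin> S" "x > frobenius S \<Longrightarrow> x \<in> S" "frobenius S \<ge> -1"
    using 1 2 3 by (simp_all add: eq)
qed

lemma numerical_semigroup_add:
  "numerical_semigroup S \<Longrightarrow> x \<in> S \<Longrightarrow> y \<in> S \<Longrightarrow> x + y \<in> S"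
  by (simp add: numerical_semigroup_def)

lemma numerical_semigroup_nonneg:
  "numerical_semigroup S \<Longrightarrow> x \<in> S \<Longrightarrow> x \<ge> 0"
  by (auto simp: numerical_semigroup_def Nats_altdef1)

lemma min_odd_properties:
  assumes S: "numerical_semigroup S"
  shows min_odd_in: "min_odd S \<in> S"
    and odd_min_odd: "odd (min_odd S)"
    and min_odd_le: "c \<in> S \<Longrightarrow> odd c \<Longrightarrow> min_odd S \<le> c"
proof -
  \<comment> \<open>\<open>2 f(S) + 3\<close> is an odd integer above \<open>f(S)\<close>, because \<open>f(S) \<ge> -1\<close>.\<close>
  define m where "m = 2 * frobenius S + 3"
  have m: "m \<in> S" "odd m"
    using gt_frobenius_in[OF S, of m] frobenius_ge[OF S] by (auto simp: m_def)
  define A where "A = {c \<in> {0..m}. c \<in> S \<and> odd c}"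
  have fin: "finite A" by (rule finite_subset[of _ "{0..m}"]) (auto simp: A_def)
  have mA: "m \<in> A" using m numerical_semigroup_nonneg[OF S] by (simp add: A_def)
  have "Min A \<in> A" using fin mA by (intro Min_in) auto
  then have 1: "Min A \<in> S \<and> odd (Min A)" by (auto simp: A_def)
  have 2: "Min A \<le> d" if "d \<in> S \<and> odd d" for d
  proof (cases "d \<le> m")
    case True
    then show ?thesis
      using that numerical_semigroup_nonneg[OF S] fin by (intro Min_le) (auto simp: A_def)
  next
    case False
    then show ?thesis using Min_le[OF fin mA] by simp
  qed
  have "min_odd S = Min A" unfolding min_odd_def using 1 2 by (rule Least_equality)
  with 1 2 show "min_odd S \<in> S" "odd (min_odd S)" "c \<in> S \<Longrightarrow> odd c \<Longrightarrow> min_odd S \<le> c"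
    by auto
qed

section \<open>Symmetry as a reflection\<close>

lemma frobenius_in_pseudo_frobenius:
  assumes "numerical_semigroup S"
  shows "frobenius S \<in> pseudo_frobenius S"
proof -
  have "frobenius S + s \<in> S" if "s \<in> S" "s \<noteq> 0" for s
    using gt_frobenius_in[OF assms, of "frobenius S + s"] numerical_semigroup_nonneg[OF assms that(1)]
      that(2) by simp
  then show ?thesis using frobenius_not_in[OF assms] by (auto simp: pseudo_frobenius_def)
qed

text \<open>For \<open>x \<notin> S\<close>, moving upwards from \<open>x\<close> by elements of \<open>S\<close> one eventually stays in \<open>S\<close>; the
  last point outside \<open>S\<close> is a pseudo-Frobenius number.\<close>

lemma shift_to_pseudo_frobenius:
  assumes S: "numerical_semigroup S" and x: "x \<notin> S"
  obtains s where "s \<in> S" and "x + s \<in> pseudo_frobenius S"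
proof -
  define A where "A = {s \<in> S. x + s \<notin> S}"
  have "A \<subseteq> {0..frobenius S - x}"
  proof
    fix s assume s: "s \<in> A"
    then have "s \<ge> 0" using numerical_semigroup_nonneg[OF S] by (auto simp: A_def)
    moreover have "\<not> frobenius S < x + s" using s gt_frobenius_in[OF S] by (auto simp: A_def)
    ultimately show "s \<in> {0..frobenius S - x}" by auto
  qed
  then have fin: "finite A" by (rule finite_subset) simp
  have "0 \<in> A" using S x by (auto simp: A_def numerical_semigroup_def)
  then have M: "Max A \<in> A" using fin by (intro Max_in) auto
  have "x + Max A + t \<in> S" if t: "t \<in> S" "t \<noteq> 0" for t
  proof (rule ccontr)
    assume "x + Max A + t \<notin> S"
    with M t numerical_semigroup_add[OF S] have "Max A + t \<in> A"
      by (auto simp: A_def add.assoc)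
    then have "Max A + t \<le> Max A" by (rule Max_ge[OF fin])
    with t numerical_semigroup_nonneg[OF S t(1)] show False by simp
  qed
  with M have "x + Max A \<in> pseudo_frobenius S" by (auto simp: A_def pseudo_frobenius_def)
  with M that show ?thesis by (auto simp: A_def)
qed

lemma symmetric_iff_reflection:
  assumes S: "numerical_semigroup S"
  shows "symmetric S \<longleftrightarrow> (\<forall>x. x \<in> S \<longleftrightarrow> frobenius S - x \<notin> S)"
proof
  assume "symmetric S"
  then have PF: "pseudo_frobenius S = {frobenius S}"
    using frobenius_in_pseudo_frobenius[OF S]
    by (auto simp: symmetric_def semigroup_type_def card_1_singleton_iff)
  show "\<forall>x. x \<in> S \<longleftrightarrow> frobenius S - x \<notin> S"
  proof (intro allI iffI)
    fix x assume "x \<in> S"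
    then show "frobenius S - x \<notin> S"
      using numerical_semigroup_add[OF S, of x "frobenius S - x"] frobenius_not_in[OF S] by auto
  next
    fix x assume "frobenius S - x \<notin> S"
    then obtain s where "s \<in> S" "frobenius S - x + s \<in> pseudo_frobenius S"
      by (rule shift_to_pseudo_frobenius[OF S])
    with PF show "x \<in> S" by simp
  qed
next
  assume refl: "\<forall>x. x \<in> S \<longleftrightarrow> frobenius S - x \<notin> S"
  have "x = frobenius S" if x: "x \<in> pseudo_frobenius S" for x
  proof (rule ccontr)
    assume "x \<noteq> frobenius S"
    moreover have "frobenius S - x \<in> S" using refl x unfolding pseudo_frobenius_def by blast
    ultimately have "frobenius S - x \<in> S - {0}" by simp
    then have "x + (frobenius S - x) \<in> S" using x unfolding pseudo_frobenius_def by blast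
    with frobenius_not_in[OF S] show False by simp
  qed
  with frobenius_in_pseudo_frobenius[OF S] have "pseudo_frobenius S = {frobenius S}" by blast
  then show "symmetric S" by (simp add: symmetric_def semigroup_type_def)
qed

text \<open>The reflection pairs the gaps in \<open>{0..F}\<close> with the elements of \<open>S\<close> in \<open>{0..F}\<close>, so
  exactly half of these \<open>F + 1\<close> integers are gaps.\<close>

lemma symmetric_genus:
  assumes S: "numerical_semigroup S" and "symmetric S"
  shows "2 * int (genus S) = frobenius S + 1"
proof -
  define F where "F = frobenius S"
  have refl: "x \<in> S \<longleftrightarrow> F - x \<notin> S" for x
    using assms symmetric_iff_reflection[OF S] unfolding F_def by blast
  have gaps: "\<nat> - S = {0..F} - S"
  proof (intro set_eqI iffI)
    fix x assume "x \<in> \<nat> - S"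
    then show "x \<in> {0..F} - S"
      using gt_frobenius_in[OF S, of x] by (force simp: Nats_altdef1 F_def)
  qed (auto simp: Nats_altdef1)
  have "bij_betw (\<lambda>x. F - x) ({0..F} - S) ({0..F} \<inter> S)"
  proof (rule bij_betw_byWitness[where f' = "\<lambda>x. F - x"])
    show "(\<lambda>x. F - x) ` ({0..F} - S) \<subseteq> {0..F} \<inter> S"
      by (fastforce intro: iffD2[OF refl])
    show "(\<lambda>x. F - x) ` ({0..F} \<inter> S) \<subseteq> {0..F} - S"
      by (fastforce dest: iffD1[OF refl])
  qed auto
  then have "card ({0..F} - S) = card ({0..F} \<inter> S)" by (rule bij_betw_same_card)
  moreover have "card {0..F} = card ({0..F} \<inter> S) + card ({0..F} - S)"
    by (metis Int_Diff_disjoint Int_Diff_Un card_Un_disjoint finite_Diff finite_Int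
        finite_atLeastAtMost_int)
  ultimately have "nat (F + 1) = 2 * genus S" by (simp add: genus_def gaps)
  with frobenius_ge[OF S] show ?thesis by (simp add: F_def)
qed

text \<open>For even \<open>F\<close> the midpoint \<open>F / 2\<close> would be fixed by the reflection.\<close>

lemma symmetric_odd_frobenius:
  assumes S: "numerical_semigroup S" and "symmetric S"
  shows "odd (frobenius S)"
proof
  assume "even (frobenius S)"
  then obtain h where "frobenius S = 2 * h" by (auto elim: evenE)
  then have "frobenius S - h = h" by simp
  moreover have "h \<in> S \<longleftrightarrow> frobenius S - h \<notin> S"
    using assms symmetric_iff_reflection[OF S] by blast
  ultimately show False by simp
qed

section \<open>The canonical ideal\<close>

lemma canonical_ideal_nonneg:
  assumes "numerical_semigroup S" and "k \<in> canonical_ideal S"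
  shows "k \<ge> 0"
  using assms(2) gt_frobenius_in[OF assms(1), of "frobenius S - k"]
  by (force simp: canonical_ideal_def)

lemma zero_in_canonical_ideal:
  assumes "numerical_semigroup S"
  shows "0 \<in> canonical_ideal S"
  using frobenius_not_in[OF assms] by (simp add: canonical_ideal_def)

lemma canonical_ideal_add:
  assumes S: "numerical_semigroup S" and k: "k \<in> canonical_ideal S" and s: "s \<in> S"
  shows "k + s \<in> canonical_ideal S"
  using k numerical_semigroup_add[OF S _ s, of "frobenius S - (k + s)"]
  by (auto simp: canonical_ideal_def algebra_simps)

text \<open>This is where almost symmetry enters: an element of \<open>K\<close> outside \<open>S\<close> lies in \<open>L(S)\<close>,
  hence is a pseudo-Frobenius number.\<close>

lemma almost_symmetric_canonical_ideal_add:
  assumes S: "numerical_semigroup S" and "almost_symmetric S"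
    and "k \<in> canonical_ideal S" and "s \<in> S" "s \<noteq> 0"
  shows "k + s \<in> S"
proof (cases "k \<in> S")
  case True
  then show ?thesis using assms numerical_semigroup_add[OF S] by blast
next
  case False
  with assms have "k \<in> pseudo_frobenius S"
    by (auto simp: almost_symmetric_def L_set_def canonical_ideal_def)
  then show ?thesis using assms by (auto simp: pseudo_frobenius_def)
qed

section \<open>Symmetric doubles are duplications\<close>

lemma even_mem_duplication:
  "odd b \<Longrightarrow> 2 * x \<in> S \<Join>\<^bsup>b\<^esup> K \<longleftrightarrow> x \<in> S" for b :: int
  by (auto simp: duplication_def dest: arg_cong[where f = even])

lemma odd_mem_duplication:
  "odd b \<Longrightarrow> 2 * k + b \<in> S \<Join>\<^bsup>b\<^esup> K \<longleftrightarrow> k \<in> K" for b :: int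
proof -
  assume b: "odd b"
  have "2 * k + b \<noteq> 2 * x" for x using b by presburger
  then show ?thesis by (auto simp: duplication_def)
qed

lemma int_parity_cases [consumes 1]:
  fixes b x :: int
  assumes "odd b"
  obtains (even) z where "x = 2 * z" | (odd) k where "x = 2 * k + b"
proof (cases "even x")
  case True
  then show ?thesis using even by (auto elim: evenE)
next
  case False
  with assms have "even (x - b)" by simp
  then obtain k where "x - b = 2 * k" by (rule evenE)
  then show ?thesis using odd[of k] by simp
qed

lemma frobenius_duplication:
  assumes S: "numerical_semigroup S" and b: "odd b" "b \<ge> 0"
  shows frobenius_duplication_not_in:
      "2 * frobenius S + b \<notin> S \<Join>\<^bsup>b\<^esup> canonical_ideal S"
    and gt_frobenius_duplication_in:
      "x > 2 * frobenius S + b \<Longrightarrow> x \<in> S \<Join>\<^bsup>b\<^esup> canonical_ideal S"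
    and frobenius_duplication_eq:
      "frobenius (S \<Join>\<^bsup>b\<^esup> canonical_ideal S) = 2 * frobenius S + b"
proof -
  let ?T = "S \<Join>\<^bsup>b\<^esup> canonical_ideal S"
  have 0: "0 \<in> S" using S by (simp add: numerical_semigroup_def)
  show 1: "2 * frobenius S + b \<notin> ?T"
    unfolding odd_mem_duplication[OF b(1)] using 0 by (simp add: canonical_ideal_def)
  have 2: "x \<in> ?T" if "x > 2 * frobenius S + b" for x
  using b(1)
  proof (cases rule: int_parity_cases[where x = x])
    case (even z)
    with that b have "z > frobenius S" by simp
    then show ?thesis
      unfolding even even_mem_duplication[OF b(1)] by (rule gt_frobenius_in[OF S])
  next
    case (odd k)
    with that have "frobenius S - k < 0" by simp
    then show ?thesis
      unfolding odd odd_mem_duplication[OF b(1)]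
      using numerical_semigroup_nonneg[OF S] by (force simp: canonical_ideal_def)
  qed
  then show "x > 2 * frobenius S + b \<Longrightarrow> x \<in> ?T" .
  show "frobenius ?T = 2 * frobenius S + b" by (rule frobenius_eqI[OF 1 2])
qed

lemma numerical_semigroup_duplication:
  assumes S: "numerical_semigroup S" and "almost_symmetric S"
    and b: "b \<in> S" "odd b"
  shows "numerical_semigroup (S \<Join>\<^bsup>b\<^esup> canonical_ideal S)"
proof -
  let ?K = "canonical_ideal S" and ?T = "S \<Join>\<^bsup>b\<^esup> canonical_ideal S"
  note even_mem = even_mem_duplication[OF b(2), of _ S ?K]
    and odd_mem = odd_mem_duplication[OF b(2), of _ S ?K]
  have b_pos: "b > 0"
    using numerical_semigroup_nonneg[OF S b(1)] b(2) by (cases "b = 0") auto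
  have sub: "?T \<subseteq> \<nat>"
    using b_pos numerical_semigroup_nonneg[OF S] canonical_ideal_nonneg[OF S]
    by (force simp: duplication_def Nats_altdef1)
  have zero: "0 \<in> ?T"
    using even_mem[of 0] S by (simp add: numerical_semigroup_def)
  have mixed: "2 * s + (2 * k + b) \<in> ?T" if "s \<in> S" "k \<in> ?K" for s k
    using odd_mem[of "k + s"] canonical_ideal_add[OF S that(2,1)] by (simp add: algebra_simps)
  have odds: "(2 * k + b) + (2 * l + b) \<in> ?T" if "k \<in> ?K" "l \<in> ?K" for k l
  proof -
    have "l + b \<in> S"
      using almost_symmetric_canonical_ideal_add[OF assms(1,2) that(2) b(1)] b_pos by simp
    moreover have "l + b \<noteq> 0" using canonical_ideal_nonneg[OF S that(2)] b_pos by simp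
    ultimately have "k + (l + b) \<in> S"
      by (rule almost_symmetric_canonical_ideal_add[OF assms(1,2) that(1)])
    then show ?thesis using even_mem[of "k + (l + b)"] by (simp add: algebra_simps)
  qed
  have add: "x + y \<in> ?T" if x: "x \<in> ?T" and y: "y \<in> ?T" for x y
  using b(2)
  proof (cases rule: int_parity_cases[where x = x])
    case (even s)
    then have s: "s \<in> S" using x even_mem by blast
    show ?thesis
    using b(2)
    proof (cases rule: int_parity_cases[where x = y])
      case (even t)
      then have "t \<in> S" using y even_mem by blast
      then have "2 * (s + t) \<in> ?T" using even_mem numerical_semigroup_add[OF S s] by blast
      then show ?thesis by (simp add: \<open>x = 2 * s\<close> even)
    next
      case (odd k)
      then have "k \<in> ?K" using y odd_mem by blast
      then show ?thesis using mixed[OF s] even odd by simp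
    qed
  next
    case (odd k)
    then have k: "k \<in> ?K" using x odd_mem by blast
    show ?thesis
    using b(2)
    proof (cases rule: int_parity_cases[where x = y])
      case (even t)
      then have "t \<in> S" using y even_mem by blast
      then show ?thesis using mixed[OF _ k] odd even by (metis add.commute)
    next
      case (odd l)
      then have "l \<in> ?K" using y odd_mem by blast
      then show ?thesis using odds[OF k] \<open>x = 2 * k + b\<close> odd by simp
    qed
  qed
  have "\<nat> - ?T \<subseteq> {0..2 * frobenius S + b}"
  proof
    fix x assume x: "x \<in> \<nat> - ?T"
    then have "\<not> x > 2 * frobenius S + b"
      using gt_frobenius_duplication_in[OF S b(2)] b_pos by auto
    with x show "x \<in> {0..2 * frobenius S + b}" by (auto simp: Nats_altdef1)
  qed
  then have "finite (\<nat> - ?T)" by (rule finite_subset) simp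
  with sub zero add show ?thesis by (simp add: numerical_semigroup_def)
qed

text \<open>The definition of \<open>K\<close> as the reflected complement of \<open>S\<close> is made for symmetry: with
  \<open>F = 2 f(S) + b\<close>, the reflection sends \<open>2 z\<close> to \<open>2 (f(S) - z) + b\<close>, so its condition on even
  integers and its condition on odd integers both say that \<open>f(S) - z \<in> K\<close> iff \<open>z \<notin> S\<close>.\<close>

lemma duplication_in_symmetric_doubles:
  assumes S: "numerical_semigroup S" and "almost_symmetric S"
    and b: "b \<in> S" "odd b"
  shows "S \<Join>\<^bsup>b\<^esup> canonical_ideal S \<in> symmetric_doubles S"
proof -
  let ?K = "canonical_ideal S" and ?T = "S \<Join>\<^bsup>b\<^esup> canonical_ideal S"
  note even_mem = even_mem_duplication[OF b(2), of _ S ?K]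
    and odd_mem = odd_mem_duplication[OF b(2), of _ S ?K]
  have F: "frobenius ?T = 2 * frobenius S + b"
    by (rule frobenius_duplication_eq[OF S b(2) numerical_semigroup_nonneg[OF S b(1)]])
  have T: "numerical_semigroup ?T" by (rule numerical_semigroup_duplication[OF assms])
  have "x \<in> ?T \<longleftrightarrow> frobenius ?T - x \<notin> ?T" for x
  using b(2)
  proof (cases rule: int_parity_cases[where x = x])
    case (even z)
    then have refl: "frobenius ?T - x = 2 * (frobenius S - z) + b" by (simp add: F)
    show ?thesis unfolding refl unfolding even even_mem odd_mem
      by (simp add: canonical_ideal_def)
  next
    case (odd k)
    then have refl: "frobenius ?T - x = 2 * (frobenius S - k)" by (simp add: F)
    show ?thesis unfolding refl unfolding odd even_mem odd_mem
      by (simp add: canonical_ideal_def)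
  qed
  then have "symmetric ?T" using symmetric_iff_reflection[OF T] by blast
  moreover have "half ?T = S"
    using even_mem S by (auto simp: half_def numerical_semigroup_def)
  ultimately show ?thesis using T by (simp add: symmetric_doubles_def)
qed

lemma symmetric_double_is_duplication:
  assumes S: "numerical_semigroup S" and "T \<in> symmetric_doubles S"
  obtains c where "c \<in> S" and "odd c" and "T = S \<Join>\<^bsup>c\<^esup> canonical_ideal S"
proof -
  have T: "numerical_semigroup T" and sym: "symmetric T" and half: "S = half T"
    using assms by (auto simp: symmetric_doubles_def)
  \<comment> \<open>The Frobenius number of a duplication along \<open>c\<close> is \<open>2 f(S) + c\<close>; this is solved for \<open>c\<close>.\<close>
  define c where "c = frobenius T - 2 * frobenius S"
  have c: "odd c" using symmetric_odd_frobenius[OF T sym] by (simp add: c_def)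
  have refl: "x \<in> T \<longleftrightarrow> frobenius T - x \<notin> T" for x
    using sym symmetric_iff_reflection[OF T] by blast
  have even_mem: "2 * z \<in> T \<longleftrightarrow> z \<in> S" for z
    using numerical_semigroup_nonneg[OF T, of "2 * z"] by (auto simp: half half_def Nats_altdef1)
  have odd_mem: "2 * k + c \<in> T \<longleftrightarrow> k \<in> canonical_ideal S" for k
  proof -
    have "2 * k + c \<in> T \<longleftrightarrow> frobenius T - (2 * k + c) \<notin> T" by (rule refl)
    also have "frobenius T - (2 * k + c) = 2 * (frobenius S - k)" by (simp add: c_def)
    also have "2 * (frobenius S - k) \<notin> T \<longleftrightarrow> k \<in> canonical_ideal S"
      by (simp only: even_mem canonical_ideal_def mem_Collect_eq)
    finally show ?thesis .
  qed
  have "c \<in> T" using odd_mem[of 0] zero_in_canonical_ideal[OF S] by simp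
  then have "c \<in> S" using even_mem[of c] numerical_semigroup_add[OF T, of c c] by simp
  moreover have "T = S \<Join>\<^bsup>c\<^esup> canonical_ideal S"
  proof (rule set_eqI)
    fix x
    show "x \<in> T \<longleftrightarrow> x \<in> S \<Join>\<^bsup>c\<^esup> canonical_ideal S"
    using c
    proof (cases rule: int_parity_cases[where x = x])
      case (even z)
      then show ?thesis using even_mem even_mem_duplication[OF c] by blast
    next
      case (odd k)
      then show ?thesis using odd_mem odd_mem_duplication[OF c] by blast
    qed
  qed
  ultimately show ?thesis using c that by blast
qed

lemma genus_symmetric_duplication:
  assumes S: "numerical_semigroup S" and c: "c \<in> S" "odd c"
    and "S \<Join>\<^bsup>c\<^esup> canonical_ideal S \<in> symmetric_doubles S"
  shows "2 * int (genus (S \<Join>\<^bsup>c\<^esup> canonical_ideal S)) = 2 * frobenius S + c + 1"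
  using assms symmetric_genus[of "S \<Join>\<^bsup>c\<^esup> canonical_ideal S"]
    frobenius_duplication_eq[OF S c(2) numerical_semigroup_nonneg[OF S c(1)]]
  by (simp add: symmetric_doubles_def)

section \<open>The double of minimal genus\<close>

theorem corollary3p3:
  fixes S K :: "int set" and b :: int
  assumes "numerical_semigroup S"
    and "almost_symmetric S"
    and "K = canonical_ideal S"
    and "b = min_odd S"
  shows "{T. is_arg_min genus (\<lambda>T. T \<in> symmetric_doubles S) T} = {S \<Join>\<^bsup>b\<^esup> K}
    \<and> real (genus (S \<Join>\<^bsup>b\<^esup> K)) = real_of_int (frobenius S) + (real_of_int b + 1) / 2"
proof -
  note S = assms(1)
  have b: "b \<in> S" "odd b" and b_min: "\<And>c. c \<in> S \<Longrightarrow> odd c \<Longrightarrow> b \<le> c"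
    using min_odd_properties[OF S] assms(4) by auto
  have D: "S \<Join>\<^bsup>b\<^esup> K \<in> symmetric_doubles S"
    unfolding assms(3) by (rule duplication_in_symmetric_doubles[OF S assms(2) b])
  have g: "2 * int (genus (S \<Join>\<^bsup>b\<^esup> K)) = 2 * frobenius S + b + 1"
    using genus_symmetric_duplication[OF S b] D assms(3) by simp
  have less: "genus (S \<Join>\<^bsup>b\<^esup> K) < genus T"
    if T: "T \<in> symmetric_doubles S" and ne: "T \<noteq> S \<Join>\<^bsup>b\<^esup> K" for T
  proof -
    obtain c where c: "c \<in> S" "odd c" and T_eq: "T = S \<Join>\<^bsup>c\<^esup> K"
      using symmetric_double_is_duplication[OF S T] assms(3) by blast
    have "b < c" using ne T_eq b_min[OF c] by (cases "b = c") auto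
    moreover have "2 * int (genus T) = 2 * frobenius S + c + 1"
      using genus_symmetric_duplication[OF S c] T T_eq assms(3) by simp
    ultimately show ?thesis using g by linarith
  qed
  have "{T. is_arg_min genus (\<lambda>T. T \<in> symmetric_doubles S) T} = {S \<Join>\<^bsup>b\<^esup> K}"
    using D less unfolding is_arg_min_def by (blast dest: less_asym)
  moreover have "real (genus (S \<Join>\<^bsup>b\<^esup> K)) = real_of_int (frobenius S) + (real_of_int b + 1) / 2"
    using arg_cong[OF g, of real_of_int] by (simp add: field_simps)
  ultimately show ?thesis ..
qed

end
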